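(* Let $p\in[1,\infty)$, $r\in(0,1/2]$, $b\ge 0$, and let $M,B>0$. Assume that a class $W\subset C(\Omega)$ of real-valued functions satisfies $\|f\|_\infty\le M$ for all $f\in W$, and that $$\varepsilon_n(W,L_\infty)\le B\,n^{-r}[\log(n+1)]^b\qquad\text{for all } n\in\mathbb{N}.$$ Then there is a constant $C=C(B,M,r,b,p)>0$ such that: 1. if $r\in(0,1/2)$, then $er_m(W,L_p)\le C\,m^{-r}[\log(m+1)]^{b}$ for all $m\in\mathbb{N}$; 2. if $r=1/2$, then $er_m(W,L_p)\le C\,m^{-1/2}[\log(m+1)]^{b+1}$ for all $m\in\mathbb{N}$.
   Context: $\Omega$ is a compact subset of $\mathbb{R}^d$, $\mu$ is a (Borel) probability measure on $\Omega$, and $C(\Omega)$ is the space of continuous functions on $\Omega$. $\|f\|_\infty=\sup_{x\in\Omega}|f(x)|$ is the uniform norm (also denoted $L_\infty$), and $\|f\|_p^p=\int_\Omega|f|^p\,d\mu$. $\log$ is the logarithm to base 2, $\mathbb{N}=\{1,2,\dots\}$. Discretization numbers: for a class $W\subset C(\Omega)$, $$er_m(W,L_p):=\inf_{\xi^1,\dots,\xi^m\in\Omega}\ \sup_{f\in W}\Bigl|\|f\|_p^p-\frac1m\sum_{j=1}^m|f(\xi^j)|^p\Bigr|.$$ Entropy numbers: for a set $W$ in a normed space $X$ and an integer $k\ge 0$, $$\varepsilon_k(W,X):=\inf\bigl\{\varepsilon>0:\ \exists\, y^1,\dots,y^{2^k}\in W \text{ with } W\subseteq\bigcup_{j=1}^{2^k}B_X(y^j,\varepsilon)\bigr\},\qquad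 B_X(y,\varepsilon)=\{x\in X:\|x-y\|_X\le\varepsilon\}.$$ $\varepsilon_k(W,L_\infty)$ means the entropy numbers with respect to the uniform norm. *)

theory Defs
  imports "HOL-Probability.Probability" "HOL-Analysis.Abstract_Euclidean_Space"
begin

text \<open>
  Euclidean space of dimension \<open>d\<close> is the library topology \<^const>\<open>Euclidean_space\<close>, whose points are
  the sequences \<open>x\<close> with \<open>x i = 0\<close> for \<open>i \<ge> d\<close>. It takes the dimension as a natural number rather
  than as a type, so that a constant can be asserted to be independent of the dimension.

  Functions on \<open>\<Omega>\<close> are total HOL functions; nothing below depends on their values outside \<open>\<Omega>\<close>.
\<close>

definition continuous_functions :: "nat \<Rightarrow> (nat \<Rightarrow> real) set \<Rightarrow> ((nat \<Rightarrow> real) \<Rightarrow> real) set" where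
  "continuous_functions d \<Omega> =
     {f. continuous_map (subtopology (Euclidean_space d) \<Omega>) euclideanreal f}"

definition borel_probability_measure :: "nat \<Rightarrow> (nat \<Rightarrow> real) set \<Rightarrow> (nat \<Rightarrow> real) measure \<Rightarrow> bool" where
  "borel_probability_measure d \<Omega> \<mu> \<longleftrightarrow>
     prob_space \<mu> \<and> space \<mu> = \<Omega> \<and>
     sets \<mu> = sigma_sets \<Omega> {U. openin (subtopology (Euclidean_space d) \<Omega>) U}"

definition sup_norm :: "'a set \<Rightarrow> ('a \<Rightarrow> real) \<Rightarrow> real" where
  "sup_norm \<Omega> f = (SUP x\<in>\<Omega>. \<bar>f x\<bar>)"

text \<open>
  The infimum is taken in \<^typ>\<open>ennreal\<close>, so that it is \<open>\<infinity>\<close> when no admissible \<open>\<epsilon>\<close> exists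
  (in particular for empty \<open>W\<close>). The argument \<open>nrm\<close> is the norm of the ambient space.
\<close>

definition entropy_number :: "('f::minus \<Rightarrow> real) \<Rightarrow> 'f set \<Rightarrow> nat \<Rightarrow> ennreal" where
  "entropy_number nrm W k =
     (INF \<epsilon> \<in> {\<epsilon>::real. \<epsilon> > 0 \<and>
        (\<exists>y::nat \<Rightarrow> 'f. (\<forall>j\<in>{1..2^k}. y j \<in> W) \<and>
           W \<subseteq> (\<Union>j\<in>{1..2^k}. {x. nrm (x - y j) \<le> \<epsilon>}))}. ennreal \<epsilon>)"

definition Lp_norm_pow :: "'a measure \<Rightarrow> real \<Rightarrow> ('a \<Rightarrow> real) \<Rightarrow> real" where
  "Lp_norm_pow \<mu> p f = (\<integral>x. \<bar>f x\<bar> powr p \<partial>\<mu>)"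

definition discretization_number ::
    "'a set \<Rightarrow> 'a measure \<Rightarrow> real \<Rightarrow> ('a \<Rightarrow> real) set \<Rightarrow> nat \<Rightarrow> ennreal" where
  "discretization_number \<Omega> \<mu> p W m =
     (INF \<xi> \<in> {\<xi>::nat \<Rightarrow> 'a. \<forall>j\<in>{1..m}. \<xi> j \<in> \<Omega>}.
        SUP f\<in>W. ennreal \<bar>Lp_norm_pow \<mu> p f - (1 / real m) * (\<Sum>j=1..m. \<bar>f (\<xi> j)\<bar> powr p)\<bar>)"

end

theory Submission
  imports Defs
begin

text \<open>
  The sampling points are chosen at random: for \<open>\<xi>\<^sup>1, \<dots>, \<xi>\<^sup>m\<close> independent with law \<open>\<mu>\<close>, chaining shows
  that with positive probability the empirical means of all \<open>\<bar>f\<bar>\<^sup>p\<close>, \<open>f \<in> W\<close>, are simultaneously close to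
  their integrals.

  Since \<open>\<bar>f\<bar> \<le> M\<close> on \<open>\<Omega>\<close>, the map \<open>f \<mapsto> \<bar>f\<bar>\<^sup>p\<close> is Lipschitz in the uniform norm with constant
  \<open>p M\<^bsup>p-1\<^esup>\<close> (\<open>abs_powr_lipschitz\<close>). Hence the class \<open>H\<close> of all \<open>\<bar>f\<bar>\<^sup>p\<close> has, for every \<open>s\<close>, a net \<open>Y\<^sub>s\<close> of at
  most \<open>2^(2^s)\<close> elements whose radius \<open>e\<^sub>s\<close> is of order \<open>2\<^bsup>-rs\<^esup> (log (m+1))\<^sup>b\<close> as long as \<open>2^s \<le> m\<close>; the
  logarithm at the index \<open>2^s\<close> has simply been replaced by its value at \<open>m\<close>, which keeps the later sums
  geometric and costs nothing in the final rate.

  Let \<open>\<pi>\<^sub>s h \<in> Y\<^sub>s\<close> be a nearest net point and \<open>2^S \<le> m < 2^(S+1)\<close>. The error of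
  \<open>h = \<pi>\<^sub>0 h + \<Sum>\<^bsub>1\<le>s\<le>S\<^esub> (\<pi>\<^sub>s h - \<pi>\<^bsub>s-1\<^esub> h) + (h - \<pi>\<^sub>S h)\<close> is at most the sum of the errors of the
  summands. The last one is at most \<open>2 e\<^sub>S\<close>, which is of the order \<open>m\<^bsup>-r\<^esup> (log (m+1))\<^sup>b\<close>. The increments
  \<open>\<pi>\<^sub>s h - \<pi>\<^bsub>s-1\<^esub> h\<close> form a set of at most \<open>2^(2^(s+1))\<close> functions bounded by
  \<open>\<delta>\<^sub>s = e\<^bsub>s-1\<^esub> + e\<^sub>s\<close>, and \<open>\<pi>\<^sub>0 h\<close> is bounded by \<open>\<delta>\<^sub>0 = M\<^sup>p\<close>. Hoeffding's inequality and a union bound make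
  all of their errors at most a constant times \<open>\<delta>\<^sub>s (2^s / m)\<^bsup>1/2\<^esup>\<close>, and the failure
  probabilities decay so quickly in \<open>s\<close> that all levels succeed together (\<open>simultaneous_sampling\<close>,
  \<open>chaining_sampling\<close>).

  It remains to sum \<open>m\<^bsup>-1/2\<^esup> \<Sum>\<^bsub>s<S\<^esub> 2\<^bsup>s(1/2-r)\<^esup>\<close>. For \<open>r < 1/2\<close> the last term dominates and gives \<open>m\<^bsup>-r\<^esup>\<close>;
  for \<open>r = 1/2\<close> all \<open>S \<le> log (m+1)\<close> terms are equal, which is the source of the additional logarithm.
\<close>

section \<open>Lipschitz continuity of the absolute power\<close>

lemma abs_powr_lipschitz:
  fixes p M x y :: real
  assumes "1 \<le> p" and "\<bar>x\<bar> \<le> M" and "\<bar>y\<bar> \<le> M"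
  shows "\<bar>\<bar>x\<bar> powr p - \<bar>y\<bar> powr p\<bar> \<le> p * M powr (p - 1) * \<bar>x - y\<bar>"
proof -
  have ordered: "v powr p - u powr p \<le> p * M powr (p - 1) * (v - u)"
    if "0 \<le> u" "u < v" "v \<le> M" for u v
  proof -
    have "continuous_on {u..v} (\<lambda>z. z powr p)"
      using that assms(1) by (intro continuous_on_powr' continuous_intros) auto
    moreover have deriv: "((\<lambda>z. z powr p) has_real_derivative p * z powr (p - 1)) (at z)" if "u < z" for z
      using that \<open>0 \<le> u\<close> by (intro has_real_derivative_powr) auto
    ultimately obtain l z where z: "u < z" "z < v"
      and l: "((\<lambda>z. z powr p) has_real_derivative l) (at z)" "v powr p - u powr p = (v - u) * l"
      using MVT[OF \<open>u < v\<close>, of "\<lambda>z. z powr p"] by (metis real_differentiable_def)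
    have "l = p * z powr (p - 1)"
      using DERIV_unique l(1) deriv[OF z(1)] by blast
    also have "\<dots> \<le> p * M powr (p - 1)"
      using z that assms(1) by (intro mult_left_mono powr_mono2) auto
    finally show ?thesis
      using l(2) \<open>u < v\<close> by (simp add: mult.commute mult_left_mono)
  qed
  have abs_values: "\<bar>\<bar>x\<bar> powr p - \<bar>y\<bar> powr p\<bar> \<le> p * M powr (p - 1) * \<bar>\<bar>x\<bar> - \<bar>y\<bar>\<bar>"
  proof (cases "\<bar>x\<bar>" "\<bar>y\<bar>" rule: linorder_cases)
    case less
    then show ?thesis
      using ordered[of "\<bar>x\<bar>" "\<bar>y\<bar>"] powr_mono2[of p "\<bar>x\<bar>" "\<bar>y\<bar>"] assms by auto
  next
    case greater
    then show ?thesis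
      using ordered[of "\<bar>y\<bar>" "\<bar>x\<bar>"] powr_mono2[of p "\<bar>y\<bar>" "\<bar>x\<bar>"] assms by auto
  qed simp
  also have "\<dots> \<le> p * M powr (p - 1) * \<bar>x - y\<bar>"
    using assms(1) by (intro mult_left_mono abs_triangle_ineq3) auto
  finally show ?thesis .
qed

section \<open>Concentration of empirical means\<close>

definition sampling_error :: "'a measure \<Rightarrow> nat \<Rightarrow> (nat \<Rightarrow> 'a) \<Rightarrow> ('a \<Rightarrow> real) \<Rightarrow> real" where
  "sampling_error \<mu> m \<xi> g = \<bar>(\<integral>x. g x \<partial>\<mu>) - (1 / real m) * (\<Sum>j=1..m. g (\<xi> j))\<bar>"

lemma (in product_prob_space) indep_vars_PiM_coordinates:
  assumes "I \<noteq> {}"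
  shows "prob_space.indep_vars (Pi\<^sub>M I M) M (\<lambda>i x. x i) I"
proof -
  interpret P: prob_space "Pi\<^sub>M I M" by (rule prob_space_PiM) (rule M.prob_space_axioms)
  show ?thesis
  proof (subst P.indep_vars_iff_distr_eq_PiM'[OF assms])
    have "distr (Pi\<^sub>M I M) (Pi\<^sub>M I M) (\<lambda>x. \<lambda>i\<in>I. x i) = distr (Pi\<^sub>M I M) (Pi\<^sub>M I M) (\<lambda>x. x)"
      by (intro distr_cong refl) (auto simp: space_PiM PiE_def extensional_restrict)
    also have "\<dots> = Pi\<^sub>M I M" by simp
    also have "\<dots> = Pi\<^sub>M I (\<lambda>i. distr (Pi\<^sub>M I M) (M i) (\<lambda>x. x i))"
      by (intro PiM_cong refl) (simp add: PiM_component)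
    finally show "distr (Pi\<^sub>M I M) (Pi\<^sub>M I M) (\<lambda>x. \<lambda>i\<in>I. x i) = Pi\<^sub>M I (\<lambda>i. distr (Pi\<^sub>M I M) (M i) (\<lambda>x. x i))" .
  qed simp
qed

text \<open>
  The coordinates of the product space are independent with law \<^term>\<open>M\<close>, so this is Hoeffding's
  inequality for values in \<open>[-\<delta>, \<delta>]\<close>. Measuring the deviation in units of \<open>\<delta>\<close> makes the bound
  independent of the size of the function. The event is stated to be measurable because a union bound
  over many functions follows.
\<close>

lemma (in prob_space) sampling_error_tail:
  fixes g :: "'a \<Rightarrow> real"
  assumes "m \<ge> 1" and g[measurable]: "g \<in> borel_measurable M"
    and bound: "\<And>x. x \<in> space M \<Longrightarrow> \<bar>g x\<bar> \<le> \<delta>" and "0 < \<delta>" and "0 \<le> t"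
  defines "P \<equiv> Pi\<^sub>M {1..m} (\<lambda>_. M)"
  shows "{\<xi>\<in>space P. sampling_error M m \<xi> g \<ge> \<delta> * t} \<in> sets P"
    and "measure P {\<xi>\<in>space P. sampling_error M m \<xi> g \<ge> \<delta> * t} \<le> 2 * exp (- (real m * t\<^sup>2 / 2))"
proof -
  interpret PP: product_prob_space "\<lambda>_. M" "{1..m}" by unfold_locales
  interpret P: prob_space P unfolding P_def by (rule prob_space_PiM) (rule prob_space_axioms)
  have comp: "distr P M (\<lambda>x. x i) = M" if "i \<in> {1..m}" for i
    unfolding P_def by (rule PP.PiM_component) (use that in auto)
  have coord[measurable]: "(\<lambda>x. x i) \<in> measurable P M" if "i \<in> {1..m}" for i
    unfolding P_def using that by measurable
  have iid: "iid_interval_bounded_random_variables P {1..m} (\<lambda>i x. g (x i)) (\<lambda>x. g (x 1)) (-\<delta>) \<delta>"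
  proof
    have "P.indep_vars (\<lambda>_. M) (\<lambda>i x. x i) {1..m}"
      unfolding P_def using PP.indep_vars_PiM_coordinates \<open>m \<ge> 1\<close> by simp
    then show "P.indep_vars (\<lambda>_. borel) (\<lambda>i x. g (x i)) {1..m}"
      by (rule P.indep_vars_compose2) simp
    have "distr P borel (\<lambda>x. g (x i)) = distr M borel g" if "i \<in> {1..m}" for i
    proof -
      have "distr M borel g = distr (distr P M (\<lambda>x. x i)) borel g"
        using comp[OF that] by simp
      also have "\<dots> = distr P borel (\<lambda>x. g (x i))"
        by (subst distr_distr[OF g coord[OF that]]) (simp add: comp_def)
      finally show ?thesis by simp
    qed
    then show "distr P borel (\<lambda>x. g (x i)) = distr P borel (\<lambda>x. g (x 1))" if "i \<in> {1..m}" for i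
      using that \<open>m \<ge> 1\<close> by simp
    show "(\<lambda>x. g (x 1)) \<in> borel_measurable P"
      using measurable_compose[OF coord g, of 1] \<open>m \<ge> 1\<close> by simp
    show "AE x in P. g (x 1) \<in> {- \<delta>..\<delta>}"
    proof (rule AE_I2)
      fix x assume "x \<in> space P"
      then have "x 1 \<in> space M" using measurable_space[OF coord, of 1] \<open>m \<ge> 1\<close> by simp
      then show "g (x 1) \<in> {- \<delta>..\<delta>}" using bound[of "x 1"] by (auto simp: abs_le_iff)
    qed
  qed (rule finite_atLeastAtMost)
  have mean: "P.expectation (\<lambda>x. g (x 1)) = (\<integral>x. g x \<partial>M)"
    using integral_distr[OF coord g, of 1] comp[of 1] \<open>m \<ge> 1\<close> by simp
  have event: "{\<xi>\<in>space P. sampling_error M m \<xi> g \<ge> \<delta> * t} =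
      {\<xi>\<in>space P. \<bar>(\<Sum>i\<in>{1..m}. g (\<xi> i)) / card {1..m} - P.expectation (\<lambda>x. g (x 1))\<bar> \<ge> \<delta> * t}"
    unfolding mean sampling_error_def by (simp add: abs_minus_commute)
  have "(\<lambda>\<xi>. g (\<xi> j)) \<in> borel_measurable P" if "j \<in> {1..m}" for j
    using measurable_compose[OF coord g] that by simp
  then have "(\<lambda>\<xi>. sampling_error M m \<xi> g) \<in> borel_measurable P"
    unfolding sampling_error_def
    by (intro borel_measurable_abs borel_measurable_diff borel_measurable_times
              borel_measurable_sum borel_measurable_const) auto
  then show "{\<xi>\<in>space P. sampling_error M m \<xi> g \<ge> \<delta> * t} \<in> sets P" by measurable
  have "measure P {\<xi>\<in>space P. sampling_error M m \<xi> g \<ge> \<delta> * t}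
      \<le> 2 * exp (-2 * real (card {1..m}) * (\<delta> * t)\<^sup>2 / (\<delta> - (- \<delta>))\<^sup>2)"
    unfolding event by (rule Hoeffding_ineq_iid.Hoeffding_ineq_abs_ge'[OF Hoeffding_ineq_iid.intro[OF iid]]) (use assms in auto)
  also have "-2 * real (card {1..m}) * (\<delta> * t)\<^sup>2 / (\<delta> - (- \<delta>))\<^sup>2 = - (real m * t\<^sup>2 / 2)"
    using \<open>0 < \<delta>\<close> by (simp add: field_simps power2_eq_square)
  finally show "measure P {\<xi>\<in>space P. sampling_error M m \<xi> g \<ge> \<delta> * t} \<le> 2 * exp (- (real m * t\<^sup>2 / 2))" .
qed

text \<open>
  The deviation allowed on level \<open>s\<close> makes each failure probability at most
  \<open>2 exp (- 4 \<cdot> 2^s)\<close>. As \<open>2 \<le> exp 1\<close>, this outweighs the number \<open>2^(2^(s+1))\<close> of functions with enough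
  to spare for a further factor \<open>2^(s+1)\<close>, so the union of all failures on level \<open>s\<close> has probability at most
  \<open>(1/2)^(s+1)\<close>. These bounds add up to less than 1, whatever the number of levels, so some sample
  avoids every failure.
\<close>

lemma (in prob_space) simultaneous_sampling:
  fixes G :: "nat \<Rightarrow> ('a \<Rightarrow> real) set" and \<delta> :: "nat \<Rightarrow> real"
  assumes "m \<ge> 1"
    and fin: "\<And>s. s \<le> S \<Longrightarrow> finite (G s)"
    and card: "\<And>s. s \<le> S \<Longrightarrow> card (G s) \<le> 2 ^ (2 ^ Suc s)"
    and meas: "\<And>s g. s \<le> S \<Longrightarrow> g \<in> G s \<Longrightarrow> g \<in> borel_measurable M"
    and bound: "\<And>s g x. s \<le> S \<Longrightarrow> g \<in> G s \<Longrightarrow> x \<in> space M \<Longrightarrow> \<bar>g x\<bar> \<le> \<delta> s"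
    and pos: "\<And>s. s \<le> S \<Longrightarrow> 0 < \<delta> s"
  shows "\<exists>\<xi>. (\<forall>j\<in>{1..m}. \<xi> j \<in> space M) \<and>
      (\<forall>s\<le>S. \<forall>g\<in>G s. sampling_error M m \<xi> g \<le> \<delta> s * sqrt (8 * 2 ^ s / real m))"
proof -
  define P where "P = Pi\<^sub>M {1..m} (\<lambda>_. M)"
  define t where "t s = sqrt (8 * 2 ^ s / real m)" for s
  define bad where "bad s g = {\<xi>\<in>space P. sampling_error M m \<xi> g \<ge> \<delta> s * t s}" for s g
  interpret P: prob_space P unfolding P_def by (rule prob_space_PiM) (rule prob_space_axioms)
  have t0: "0 \<le> t s" for s by (simp add: t_def)
  have bad_event: "bad s g \<in> sets P" "measure P (bad s g) \<le> 2 * exp (- (4 * 2 ^ s))"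
    if "s \<le> S" "g \<in> G s" for s g
  proof -
    have "real m * (t s)\<^sup>2 / 2 = 4 * 2 ^ s"
      using \<open>m \<ge> 1\<close> by (simp add: t_def)
    then show "bad s g \<in> sets P" "measure P (bad s g) \<le> 2 * exp (- (4 * 2 ^ s))"
      using sampling_error_tail[OF \<open>m \<ge> 1\<close> meas[OF that] bound[OF that] pos[OF that(1)] t0, of s]
      unfolding bad_def P_def by simp_all
  qed
  define Bad where "Bad s = (\<Union>g\<in>G s. bad s g)" for s
  have Bad_event: "Bad s \<in> sets P" if "s \<le> S" for s
    unfolding Bad_def using bad_event(1)[OF that] fin[OF that] by (intro sets.finite_UN) auto
  have level: "measure P (Bad s) \<le> (1 / 2) ^ Suc s" if "s \<le> S" for s
  proof -
    have two: "(2::real) ^ n \<le> exp (real n)" for n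
      using power_mono[of "2::real" "exp 1" n] exp_ge_add_one_self[of 1] by (simp flip: exp_of_nat_mult)
    have regroup: "(2::real) ^ n * (2 * c) = 2 ^ (n + Suc (Suc s)) * c * (1 / 2) ^ Suc s" for n c
      by (simp add: power_add power_one_over)
    have cancel: "x * exp (- c) \<le> 1" if "x \<le> exp c" for x c :: real
      using that by (simp add: exp_minus field_simps)
    have "measure P (Bad s) \<le> (\<Sum>g\<in>G s. measure P (bad s g))"
      unfolding Bad_def using bad_event(1) fin that
      by (intro P.finite_measure_subadditive_finite) auto
    also have "\<dots> \<le> real (card (G s)) * (2 * exp (- (4 * 2 ^ s)))"
      using bad_event(2) that by (intro sum_bounded_above) auto
    also have "\<dots> \<le> 2 ^ (2 ^ Suc s) * (2 * exp (- (4 * 2 ^ s)))"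
    proof (intro mult_right_mono)
      have "real (card (G s)) \<le> real (2 ^ (2 ^ Suc s))"
        using card[OF that] by (simp only: of_nat_le_iff)
      then show "real (card (G s)) \<le> 2 ^ (2 ^ Suc s)" by simp
    qed simp
    also have "\<dots> = 2 ^ (2 ^ Suc s + Suc (Suc s)) * exp (- (4 * 2 ^ s)) * (1 / 2) ^ Suc s"
      by (rule regroup)
    also have "\<dots> \<le> 1 * (1 / 2) ^ Suc s"
    proof (intro mult_right_mono)
      \<comment> \<open>The exponent is at most \<open>2 \<cdot> 2^s + (2^s + 1)\<close>, and \<open>1 \<le> 2^s\<close>; this is where the constant 8 under
        the square root comes from.\<close>
      have "Suc s \<le> 2 ^ s" by (induction s) auto
      then have "2 ^ Suc s + Suc (Suc s) \<le> 4 * (2::nat) ^ s" by simp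
      then have "real (2 ^ Suc s + Suc (Suc s)) \<le> 4 * 2 ^ s"
        by (metis of_nat_le_iff of_nat_mult of_nat_numeral of_nat_power)
      then have "(2::real) ^ (2 ^ Suc s + Suc (Suc s)) \<le> exp (4 * 2 ^ s)"
        by (intro order.trans[OF two]) simp
      then show "2 ^ (2 ^ Suc s + Suc (Suc s)) * exp (- (4 * 2 ^ s)) \<le> (1::real)"
        by (rule cancel)
    qed simp
    finally show ?thesis by simp
  qed
  have "measure P (\<Union>s\<in>{..S}. Bad s) \<le> (\<Sum>s\<le>S. measure P (Bad s))"
    using Bad_event by (intro P.finite_measure_subadditive_finite) auto
  also have "\<dots> \<le> (\<Sum>s\<le>S. (1 / 2) ^ Suc s)"
    using level by (intro sum_mono) auto
  also have "\<dots> = 1 - (1 / 2) ^ Suc S"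
    by (induction S) auto
  also have "\<dots> < 1" by simp
  finally have "measure P (\<Union>s\<in>{..S}. Bad s) < measure P (space P)"
    by (simp add: P.prob_space)
  then have "\<not> space P \<subseteq> (\<Union>s\<in>{..S}. Bad s)"
    using P.finite_measure_mono[of "space P" "\<Union>s\<in>{..S}. Bad s"] Bad_event
    by (meson atMost_iff finite_atMost not_le sets.finite_UN)
  then obtain \<xi> where \<xi>: "\<xi> \<in> space P" "\<And>s g. s \<le> S \<Longrightarrow> g \<in> G s \<Longrightarrow> \<xi> \<notin> bad s g"
    unfolding Bad_def by blast
  show ?thesis
  proof (intro exI conjI allI impI ballI)
    show "\<xi> j \<in> space M" if "j \<in> {1..m}" for j
      using \<xi>(1) that by (auto simp: P_def space_PiM)
    show "sampling_error M m \<xi> g \<le> \<delta> s * sqrt (8 * 2 ^ s / real m)" if "s \<le> S" "g \<in> G s" for s g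
      using \<xi>(2)[OF that] \<xi>(1) by (auto simp: bad_def t_def)
  qed
qed

section \<open>Chaining along a sequence of nets\<close>

lemma sampling_error_triangle:
  assumes "integrable \<mu> u" "integrable \<mu> v"
  shows "sampling_error \<mu> m \<xi> u \<le> sampling_error \<mu> m \<xi> v + sampling_error \<mu> m \<xi> (\<lambda>x. u x - v x)"
  unfolding sampling_error_def
  by (simp add: Bochner_Integration.integral_diff[OF assms] sum_subtractf right_diff_distrib)

lemma (in prob_space) sampling_error_bounded:
  assumes "m \<ge> 1" and "g \<in> borel_measurable M" and bound: "\<And>x. x \<in> space M \<Longrightarrow> \<bar>g x\<bar> \<le> e"
    and "\<forall>j\<in>{1..m}. \<xi> j \<in> space M"
  shows "sampling_error M m \<xi> g \<le> 2 * e"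
proof -
  have "\<bar>\<integral>x. g x \<partial>M\<bar> \<le> (\<integral>x. \<bar>g x\<bar> \<partial>M)"
    by (rule integral_abs_bound)
  also have "\<dots> \<le> e"
    using assms by (intro integral_le_const integrable_abs integrable_const_bound[of _ e] AE_I2) auto
  finally have mean: "\<bar>\<integral>x. g x \<partial>M\<bar> \<le> e" .
  have "\<bar>\<Sum>j=1..m. g (\<xi> j)\<bar> \<le> (\<Sum>j=1..m. \<bar>g (\<xi> j)\<bar>)"
    by (rule sum_abs)
  also have "\<dots> \<le> real (card {1..m}) * e"
    using assms by (intro sum_bounded_above) auto
  finally have "\<bar>(1 / real m) * (\<Sum>j=1..m. g (\<xi> j))\<bar> \<le> e"
    using \<open>m \<ge> 1\<close> by (simp add: abs_mult field_simps)
  with mean show ?thesis unfolding sampling_error_def by linarith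
qed

text \<open>
  The random argument is applied only to finitely many functions: the coarsest net and the
  differences of neighbouring points in consecutive nets. Every \<open>h\<close> is reached from the coarsest net by
  such differences up to an error \<open>e S\<close>, which is estimated deterministically.
\<close>

lemma (in prob_space) chaining_sampling:
  fixes H :: "('a \<Rightarrow> real) set" and Y :: "nat \<Rightarrow> ('a \<Rightarrow> real) set" and e :: "nat \<Rightarrow> real"
  assumes "m \<ge> 1"
    and meas: "\<And>h. h \<in> H \<Longrightarrow> h \<in> borel_measurable M"
    and bound: "\<And>h x. h \<in> H \<Longrightarrow> x \<in> space M \<Longrightarrow> \<bar>h x\<bar> \<le> a" and "0 < a"
    and Y: "\<And>s. s \<le> S \<Longrightarrow> finite (Y s)" "\<And>s. s \<le> S \<Longrightarrow> card (Y s) \<le> 2 ^ (2 ^ s)"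
           "\<And>s. s \<le> S \<Longrightarrow> Y s \<subseteq> H"
    and net: "\<And>s h. s \<le> S \<Longrightarrow> h \<in> H \<Longrightarrow> \<exists>y\<in>Y s. \<forall>x\<in>space M. \<bar>h x - y x\<bar> \<le> e s"
    and pos: "\<And>s. 0 < e s"
  obtains \<xi> where "\<forall>j\<in>{1..m}. \<xi> j \<in> space M"
    and "\<And>h. h \<in> H \<Longrightarrow> sampling_error M m \<xi> h \<le> 2 * e S + a * sqrt (8 / real m)
           + (\<Sum>s<S. (e s + e (Suc s)) * sqrt (8 * 2 ^ Suc s / real m))"
proof -
  \<comment> \<open>Only close pairs are kept: this bounds the differences uniformly, and every link of a chain
    \<open>\<pi> s h, \<pi> (s + 1) h\<close> is such a pair, because both points are close to \<open>h\<close>.\<close>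
  define diffs where "diffs s = {w. \<exists>u v. u \<in> Y (Suc s) \<and> v \<in> Y s \<and> w = (\<lambda>x. u x - v x)
      \<and> (\<forall>x\<in>space M. \<bar>u x - v x\<bar> \<le> e s + e (Suc s))}" for s
  define G where "G s = (case s of 0 \<Rightarrow> Y 0 | Suc s' \<Rightarrow> diffs s')" for s
  define \<delta> where "\<delta> s = (case s of 0 \<Rightarrow> a | Suc s' \<Rightarrow> e s' + e (Suc s'))" for s
  have G_simps: "G 0 = Y 0" "G (Suc s) = diffs s" "\<delta> 0 = a" "\<delta> (Suc s) = e s + e (Suc s)" for s
    by (simp_all add: G_def \<delta>_def)
  have diffs_sub: "diffs s \<subseteq> (\<lambda>(u, v). \<lambda>x. u x - v x) ` (Y (Suc s) \<times> Y s)" for s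
    unfolding diffs_def by auto
  have finG: "finite (G s)" if "s \<le> S" for s
    using that Y(1) finite_subset[OF diffs_sub] by (cases s) (auto simp: G_simps)
  have cardG: "card (G s) \<le> 2 ^ (2 ^ Suc s)" if "s \<le> S" for s
  proof (cases s)
    case 0
    then show ?thesis using Y(2)[of 0] by (simp add: G_simps)
  next
    case (Suc s')
    have "card (diffs s') \<le> card (Y (Suc s') \<times> Y s')"
      using Suc that Y(1) by (intro surj_card_le[OF _ diffs_sub]) auto
    also have "\<dots> \<le> 2 ^ (2 ^ Suc s') * 2 ^ (2 ^ s')"
      unfolding card_cartesian_product using Suc that by (intro mult_mono Y(2)) auto
    also have "\<dots> \<le> 2 ^ (2 ^ Suc s)"
      unfolding Suc power_add[symmetric] by (intro power_increasing) auto
    finally show ?thesis by (simp add: Suc G_simps)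
  qed
  have measG: "g \<in> borel_measurable M" if "s \<le> S" "g \<in> G s" for s g
  proof (cases s)
    case 0
    then show ?thesis using that Y(3)[of 0] meas by (auto simp: G_simps)
  next
    case (Suc s')
    have "g \<in> diffs s'"
      using \<open>g \<in> G s\<close> by (simp add: Suc G_simps)
    then obtain u v where uv: "u \<in> Y (Suc s')" "v \<in> Y s'" "g = (\<lambda>x. u x - v x)"
      unfolding diffs_def by blast
    then have "u \<in> borel_measurable M" "v \<in> borel_measurable M"
      using Y(3)[of "Suc s'"] Y(3)[of s'] \<open>s \<le> S\<close> Suc meas by auto
    then show ?thesis by (simp add: uv(3))
  qed
  have boundG: "\<bar>g x\<bar> \<le> \<delta> s" if "s \<le> S" "g \<in> G s" "x \<in> space M" for s g x
    using that Y(3)[of 0] bound by (cases s) (auto simp: G_simps diffs_def)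
  have posG: "0 < \<delta> s" if "s \<le> S" for s
    using pos[of "s - 1"] pos[of s] \<open>0 < a\<close> by (cases s) (auto simp: G_simps)
  have "\<exists>\<xi>. (\<forall>j\<in>{1..m}. \<xi> j \<in> space M) \<and>
      (\<forall>s\<le>S. \<forall>g\<in>G s. sampling_error M m \<xi> g \<le> \<delta> s * sqrt (8 * 2 ^ s / real m))"
    by (rule simultaneous_sampling) (fact \<open>m \<ge> 1\<close> finG cardG measG boundG posG)+
  then obtain \<xi> where \<xi>: "\<forall>j\<in>{1..m}. \<xi> j \<in> space M"
    and err: "\<And>s g. s \<le> S \<Longrightarrow> g \<in> G s \<Longrightarrow> sampling_error M m \<xi> g \<le> \<delta> s * sqrt (8 * 2 ^ s / real m)"
    by blast
  have int: "integrable M h" if "h \<in> H" for h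
    using that meas bound by (intro integrable_const_bound[of _ a] AE_I2) auto
  have "sampling_error M m \<xi> h \<le> 2 * e S + a * sqrt (8 / real m)
           + (\<Sum>s<S. (e s + e (Suc s)) * sqrt (8 * 2 ^ Suc s / real m))" if "h \<in> H" for h
  proof -
    obtain \<pi> where \<pi>: "\<And>s. s \<le> S \<Longrightarrow> \<pi> s \<in> Y s"
      "\<And>s x. s \<le> S \<Longrightarrow> x \<in> space M \<Longrightarrow> \<bar>h x - \<pi> s x\<bar> \<le> e s"
      using net[OF _ \<open>h \<in> H\<close>] by metis
    have \<pi>H: "\<pi> s \<in> H" if "s \<le> S" for s
      using \<pi>(1)[OF that] Y(3)[OF that] by auto
    have chain: "sampling_error M m \<xi> (\<pi> s) \<le> a * sqrt (8 / real m)
           + (\<Sum>s<s. (e s + e (Suc s)) * sqrt (8 * 2 ^ Suc s / real m))" if "s \<le> S" for s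
      using that
    proof (induction s)
      case 0
      then show ?case using err[of 0 "\<pi> 0"] \<pi>(1)[of 0] by (simp add: G_simps)
    next
      case (Suc s)
      have "\<bar>\<pi> (Suc s) x - \<pi> s x\<bar> \<le> e s + e (Suc s)" if "x \<in> space M" for x
        using \<pi>(2)[OF _ that, of s] \<pi>(2)[OF _ that, of "Suc s"] Suc.prems by linarith
      moreover have "\<pi> (Suc s) \<in> Y (Suc s)" "\<pi> s \<in> Y s"
        using \<pi>(1) Suc.prems by simp_all
      ultimately have "(\<lambda>x. \<pi> (Suc s) x - \<pi> s x) \<in> G (Suc s)"
        unfolding G_simps diffs_def by blast
      from err[OF Suc.prems this]
      have "sampling_error M m \<xi> (\<lambda>x. \<pi> (Suc s) x - \<pi> s x)
          \<le> (e s + e (Suc s)) * sqrt (8 * 2 ^ Suc s / real m)"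
        by (simp only: G_simps)
      moreover have "sampling_error M m \<xi> (\<pi> (Suc s))
          \<le> sampling_error M m \<xi> (\<pi> s) + sampling_error M m \<xi> (\<lambda>x. \<pi> (Suc s) x - \<pi> s x)"
        using Suc.prems \<pi>H int by (intro sampling_error_triangle) auto
      ultimately show ?case using Suc.IH Suc.prems by simp
    qed
    have "sampling_error M m \<xi> h \<le> sampling_error M m \<xi> (\<pi> S) + sampling_error M m \<xi> (\<lambda>x. h x - \<pi> S x)"
      using \<pi>H int \<open>h \<in> H\<close> by (intro sampling_error_triangle) auto
    moreover have "sampling_error M m \<xi> (\<lambda>x. h x - \<pi> S x) \<le> 2 * e S"
      using \<pi>(2)[of S] meas[OF \<open>h \<in> H\<close>] meas[OF \<pi>H[of S]]
      by (intro sampling_error_bounded \<open>m \<ge> 1\<close> \<xi>) auto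
    ultimately show ?thesis using chain[of S] by simp
  qed
  with \<xi> show thesis by (rule that)
qed

section \<open>Entropy nets and continuous functions\<close>

text \<open>
  The infimum defining an entropy number may fail to be attained, hence the strictly larger radius
  \<open>\<epsilon>'\<close>.
\<close>

lemma entropy_number_net:
  assumes "entropy_number nrm W k \<le> ennreal \<epsilon>" and "0 \<le> \<epsilon>" and "\<epsilon> < \<epsilon>'"
  obtains Y where "finite Y" "card Y \<le> 2 ^ k" "Y \<subseteq> W" "\<And>f. f \<in> W \<Longrightarrow> \<exists>y\<in>Y. nrm (f - y) \<le> \<epsilon>'"
proof -
  have "entropy_number nrm W k < ennreal \<epsilon>'"
    using assms by (intro le_less_trans[OF assms(1)]) (simp add: ennreal_less_iff)
  then obtain \<eta> :: real and y :: "nat \<Rightarrow> _" where "0 < \<eta>" and \<eta>: "ennreal \<eta> < ennreal \<epsilon>'"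
    and y: "\<forall>j\<in>{1..2^k}. y j \<in> W" "W \<subseteq> (\<Union>j\<in>{1..2^k}. {x. nrm (x - y j) \<le> \<eta>})"
    unfolding entropy_number_def INF_less_iff by blast
  have "\<eta> < \<epsilon>'"
    using \<eta> \<open>0 < \<eta>\<close> by (simp add: ennreal_less_iff)
  show thesis
  proof
    show "finite (y ` {1..2^k})" by simp
    show "card (y ` {1..2^k}) \<le> 2 ^ k" by (rule order.trans[OF card_image_le]) simp_all
    show "y ` {1..2^k} \<subseteq> W" using y(1) by auto
    show "\<exists>z\<in>y ` {1..2^k}. nrm (f - z) \<le> \<epsilon>'" if f: "f \<in> W" for f
    proof -
      obtain j where "j \<in> {1..2^k}" "nrm (f - y j) \<le> \<eta>"
        using y(2) f by blast
      then show ?thesis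
        using \<open>\<eta> < \<epsilon>'\<close> by (intro bexI[of _ "y j"] imageI) simp_all
    qed
  qed
qed

lemma continuous_functions_measurable:
  assumes "borel_probability_measure d \<Omega> \<mu>" and "f \<in> continuous_functions d \<Omega>"
    and "\<Omega> \<subseteq> topspace (Euclidean_space d)"
  shows "f \<in> borel_measurable \<mu>"
proof (rule borel_measurableI)
  fix U :: "real set" assume "open U"
  then have "openin (subtopology (Euclidean_space d) \<Omega>)
      {x \<in> topspace (subtopology (Euclidean_space d) \<Omega>). f x \<in> U}"
    using assms(2) by (intro openin_continuous_map_preimage) (auto simp: continuous_functions_def)
  moreover have "{x \<in> topspace (subtopology (Euclidean_space d) \<Omega>). f x \<in> U} = f -` U \<inter> space \<mu>"
    using assms(1,3) by (auto simp: borel_probability_measure_def)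
  ultimately show "f -` U \<inter> space \<mu> \<in> sets \<mu>"
    using assms(1) by (auto simp: borel_probability_measure_def)
qed

text \<open>
  Compactness of \<open>\<Omega>\<close> is what makes the supremum bound the values: the supremum of an unbounded set of
  reals is an unspecified number.
\<close>

lemma abs_le_sup_norm_diff:
  assumes "compactin (Euclidean_space d) \<Omega>"
    and "f \<in> continuous_functions d \<Omega>" "g \<in> continuous_functions d \<Omega>" and "x \<in> \<Omega>"
  shows "\<bar>f x - g x\<bar> \<le> sup_norm \<Omega> (f - g)"
proof -
  have "continuous_map (subtopology (Euclidean_space d) \<Omega>) euclideanreal (\<lambda>x. \<bar>f x - g x\<bar>)"
    using assms(2,3) unfolding continuous_functions_def
    by (intro continuous_map_real_abs continuous_map_diff) auto
  then have "compactin euclideanreal ((\<lambda>x. \<bar>f x - g x\<bar>) ` \<Omega>)"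
    using assms(1) by (intro image_compactin[of "subtopology (Euclidean_space d) \<Omega>"])
      (auto simp: compactin_subtopology)
  then have "bdd_above ((\<lambda>x. \<bar>f x - g x\<bar>) ` \<Omega>)"
    by (simp add: compact_imp_bounded bounded_imp_bdd_above)
  then show ?thesis
    unfolding sup_norm_def minus_apply by (intro cSUP_upper \<open>x \<in> \<Omega>\<close>)
qed

lemma abs_le_sup_norm:
  assumes "compactin (Euclidean_space d) \<Omega>" and "f \<in> continuous_functions d \<Omega>" and "x \<in> \<Omega>"
  shows "\<bar>f x\<bar> \<le> sup_norm \<Omega> f"
proof -
  have "(\<lambda>_. 0) \<in> continuous_functions d \<Omega>"
    by (simp add: continuous_functions_def)
  from abs_le_sup_norm_diff[OF assms(1,2) this assms(3)] show ?thesis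
    by (simp add: sup_norm_def)
qed

section \<open>Summation over the levels\<close>

text \<open>
  The number of levels is chosen with \<open>2^S \<approx> m\<close>, which turns the deterministic remainder \<open>e S\<close> into
  the target rate \<open>m\<^bsup>-r\<^esup>\<close>. The sum is left unevaluated because its behaviour is what separates
  the cases \<open>r < 1/2\<close> and \<open>r = 1/2\<close>.
\<close>

lemma chaining_sum_bound:
  fixes A a r :: real
  assumes "0 \<le> A" "0 \<le> a" "0 < r" "r \<le> 1/2" and S: "2 ^ S \<le> m" "m < 2 ^ Suc S"
  defines "e \<equiv> \<lambda>s::nat. A * (2 ^ s) powr (- r)"
  shows "2 * e S + a * sqrt (8 / real m) + (\<Sum>s<S. (e s + e (Suc s)) * sqrt (8 * 2 ^ Suc s / real m))
     \<le> 4 * A * real m powr (- r) + 3 * a * real m powr (-1/2)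
       + 8 * A * real m powr (-1/2) * (\<Sum>s<S. (2 powr (1/2 - r)) ^ s)"
proof -
  have m: "real m > 0" using S(1) by (metis gr0I of_nat_0_less_iff not_le zero_less_numeral zero_less_power)
  have sqrt_m: "real m powr (-1/2) = 1 / sqrt (real m)"
    using m by (simp add: powr_minus powr_half_sqrt divide_simps)
  have mono: "(2 ^ Suc s) powr (- r) \<le> (2 ^ s) powr (- r)" for s :: nat
    using assms(3) by (intro powr_mono2') auto
  have "(2::real) ^ Suc S \<ge> real m"
    using S(2) by (metis less_imp_le of_nat_le_iff of_nat_numeral of_nat_power)
  then have "(2 ^ S) powr (- r) \<le> (real m / 2) powr (- r)"
    using m assms(3) by (intro powr_mono2') auto
  also have "\<dots> = 2 powr r * real m powr (- r)"
    using m by (simp add: powr_divide powr_minus field_simps)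
  also have "\<dots> \<le> 2 * real m powr (- r)"
    using powr_mono[of r 1 "2::real"] assms(4) by (intro mult_right_mono) auto
  finally have last: "2 * e S \<le> 4 * A * real m powr (- r)"
    using mult_left_mono[of _ _ A] assms(1) unfolding e_def by fastforce
  have "sqrt 8 \<le> (3::real)" by (rule real_le_lsqrt) auto
  then have first: "a * sqrt (8 / real m) \<le> 3 * a * real m powr (-1/2)"
    using m assms(2) unfolding sqrt_m real_sqrt_divide by (simp add: field_simps mult_left_mono)
  have "(e s + e (Suc s)) * sqrt (8 * 2 ^ Suc s / real m)
      \<le> 8 * A * real m powr (-1/2) * (2 powr (1/2 - r)) ^ s" for s
  proof -
    have "8 * 2 ^ Suc s / real m = 4\<^sup>2 * (2 ^ s / real m)" by simp
    then have "sqrt (8 * 2 ^ Suc s / real m) = 4 * (sqrt (2 ^ s) * real m powr (-1/2))"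
      unfolding sqrt_m by (simp only: real_sqrt_mult real_sqrt_divide real_sqrt_abs) simp
    moreover have "e s + e (Suc s) \<le> 2 * (A * (2 ^ s) powr (- r))"
      using mult_left_mono[OF mono assms(1), of s] by (simp add: e_def)
    ultimately have "(e s + e (Suc s)) * sqrt (8 * 2 ^ Suc s / real m)
        \<le> 2 * (A * (2 ^ s) powr (- r)) * (4 * (sqrt (2 ^ s) * real m powr (-1/2)))"
      by (simp only:) (intro mult_right_mono, auto)
    also have "\<dots> = 8 * A * real m powr (-1/2) * ((2 ^ s) powr (1/2) * (2 ^ s) powr (- r))"
      by (simp add: powr_half_sqrt)
    also have "(2 ^ s) powr (1/2) * (2 ^ s) powr (- r) = (2 powr (1/2 - r)) ^ s"
      by (simp add: powr_realpow[symmetric] powr_powr powr_add[symmetric] algebra_simps)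
    finally show ?thesis .
  qed
  then have "(\<Sum>s<S. (e s + e (Suc s)) * sqrt (8 * 2 ^ Suc s / real m))
      \<le> 8 * A * real m powr (-1/2) * (\<Sum>s<S. (2 powr (1/2 - r)) ^ s)"
    unfolding sum_distrib_left by (intro sum_mono)
  with last first show ?thesis by linarith
qed

text \<open>
  For \<open>r < 1/2\<close> the geometric sum is comparable to its largest term
  \<open>(2^S)\<^bsup>1/2-r\<^esup> \<le> m\<^bsup>1/2-r\<^esup>\<close>, and \<open>m\<^bsup>-1/2\<^esup>\<close> turns it into \<open>m\<^bsup>-r\<^esup>\<close>. The term with \<open>a\<close> is of no larger
  order, because \<open>m\<^bsup>-1/2\<^esup> \<le> m\<^bsup>-r\<^esup>\<close> and the logarithm is at least 1 for \<open>m \<ge> 1\<close>.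
\<close>

lemma chaining_rate_subcritical:
  fixes r b c a :: real
  assumes "r < 1/2" "0 \<le> b" "0 \<le> c" "0 \<le> a" and S: "2 ^ S \<le> m" and "m \<ge> 1"
  defines "q \<equiv> 2 powr (1/2 - r)" and "\<Lambda> \<equiv> (log 2 (real m + 1)) powr b"
  shows "4 * (c * \<Lambda>) * real m powr (- r) + 3 * a * real m powr (-1/2)
       + 8 * (c * \<Lambda>) * real m powr (-1/2) * (\<Sum>s<S. q ^ s)
     \<le> (4 * c + 3 * a + 8 * c / (q - 1)) * real m powr (- r) * \<Lambda>"
proof -
  have q: "q > 1" unfolding q_def using assms(1) by simp
  have "1 \<le> log 2 (real m + 1)" using \<open>m \<ge> 1\<close> by (subst one_le_log_cancel_iff) auto
  then have \<Lambda>: "1 \<le> \<Lambda>" unfolding \<Lambda>_def using assms(2) by (rule ge_one_powr_ge_zero)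
  have "real m powr (-1/2) \<le> real m powr (- r)"
    using assms(1) \<open>m \<ge> 1\<close> by (intro powr_mono) auto
  then have "real m powr (-1/2) * 1 \<le> real m powr (- r) * \<Lambda>"
    using \<Lambda> by (intro mult_mono) auto
  then have first: "3 * a * real m powr (-1/2) \<le> 3 * a * (real m powr (- r) * \<Lambda>)"
    using assms(4) by (intro mult_left_mono) auto
  have "q ^ S = (2 ^ S) powr (1/2 - r)"
    unfolding q_def by (simp add: powr_realpow[symmetric] powr_powr mult.commute)
  also have "\<dots> \<le> real m powr (1/2 - r)"
    using S assms(1) by (intro powr_mono2) (auto simp flip: of_nat_le_iff)
  finally have "(q ^ S - 1) / (q - 1) \<le> real m powr (1/2 - r) / (q - 1)"
    using q by (intro divide_right_mono) auto
  then have "(\<Sum>s<S. q ^ s) \<le> real m powr (1/2 - r) / (q - 1)"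
    using q by (simp add: geometric_sum)
  then have "8 * (c * \<Lambda>) * real m powr (-1/2) * (\<Sum>s<S. q ^ s)
      \<le> 8 * (c * \<Lambda>) * real m powr (-1/2) * (real m powr (1/2 - r) / (q - 1))"
    using assms(3) \<Lambda> by (intro mult_left_mono) auto
  also have "\<dots> = 8 * (c * \<Lambda>) / (q - 1) * (real m powr (-1/2) * real m powr (1/2 - r))"
    by simp
  also have "real m powr (-1/2) * real m powr (1/2 - r) = real m powr (- r)"
    by (simp flip: powr_add)
  finally show ?thesis using first by (simp add: algebra_simps)
qed

text \<open>
  For \<open>r = 1/2\<close> the sum is the number \<open>S\<close> of levels, and \<open>2^S \<le> m\<close> bounds it by one more
  logarithm.
\<close>

lemma chaining_rate_critical:
  fixes b c a :: real
  assumes "0 \<le> b" "0 \<le> c" "0 \<le> a" and S: "2 ^ S \<le> m" and "m \<ge> 1"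
  defines "\<Lambda> \<equiv> log 2 (real m + 1)"
  shows "4 * (c * \<Lambda> powr b) * real m powr (-1/2) + 3 * a * real m powr (-1/2)
       + 8 * (c * \<Lambda> powr b) * real m powr (-1/2) * real S
     \<le> (12 * c + 3 * a) * real m powr (-1/2) * \<Lambda> powr (b + 1)"
proof -
  have \<Lambda>: "1 \<le> \<Lambda>" unfolding \<Lambda>_def using \<open>m \<ge> 1\<close> by (subst one_le_log_cancel_iff) auto
  have "(2::real) ^ S \<le> real m" using S by (simp flip: of_nat_le_iff)
  then have "2 powr real S \<le> real m + 1" unfolding powr_realpow[OF zero_less_numeral] by linarith
  then have "real S \<le> \<Lambda>"
    unfolding \<Lambda>_def by (simp add: le_log_iff)
  then have "\<Lambda> powr b * real S \<le> \<Lambda> powr (b + 1)"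
    using \<Lambda> by (simp add: powr_add mult_left_mono)
  then have "8 * c * (\<Lambda> powr b * real S) \<le> 8 * c * \<Lambda> powr (b + 1)"
    using assms(2) by (intro mult_left_mono) auto
  moreover have "4 * c * \<Lambda> powr b \<le> 4 * c * \<Lambda> powr (b + 1)"
    using \<Lambda> assms(2) by (intro mult_left_mono powr_mono) auto
  moreover have "3 * a * 1 \<le> 3 * a * \<Lambda> powr (b + 1)"
    using \<Lambda> assms(1,3) by (intro mult_left_mono ge_one_powr_ge_zero) auto
  ultimately have "4 * c * \<Lambda> powr b + 3 * a + 8 * c * (\<Lambda> powr b * real S)
      \<le> (12 * c + 3 * a) * \<Lambda> powr (b + 1)"
    by (simp add: algebra_simps)
  from mult_right_mono[OF this, of "real m powr (-1/2)"] show ?thesis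
    by (simp add: algebra_simps)
qed

section \<open>Discretization of the class\<close>

text \<open>
  The nets of \<open>W\<close> are carried over to the class of functions \<open>\<bar>f\<bar>\<^sup>p\<close>, to which chaining applies. In the
  constant \<open>A\<close>, the factor \<open>p M\<^bsup>p-1\<^esup>\<close> is the Lipschitz constant of that passage, \<open>2 B\<close> leaves room above the
  entropy number, and the logarithm at \<open>m\<close> bounds those at all indices \<open>2^s \<le> m\<close>.
\<close>

lemma discretization_number_chaining:
  fixes p r b M B :: real
  assumes "1 \<le> p" "0 < r" "r \<le> 1/2" "0 \<le> b" "0 < M" "0 < B" and S: "2 ^ S \<le> m" "m < 2 ^ Suc S"
    and compact: "compactin (Euclidean_space d) \<Omega>" and \<mu>: "borel_probability_measure d \<Omega> \<mu>"
    and W: "W \<subseteq> continuous_functions d \<Omega>" and bound: "\<forall>f\<in>W. sup_norm \<Omega> f \<le> M"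
    and entropy: "\<forall>n::nat. n \<ge> 1 \<longrightarrow> entropy_number (sup_norm \<Omega>) W n
                \<le> ennreal (B * real n powr (- r) * (log 2 (real n + 1)) powr b)"
  defines "A \<equiv> p * M powr (p - 1) * (2 * B) * (log 2 (real m + 1)) powr b"
  shows "discretization_number \<Omega> \<mu> p W m \<le> ennreal (4 * A * real m powr (- r)
       + 3 * M powr p * real m powr (-1/2)
       + 8 * A * real m powr (-1/2) * (\<Sum>s<S. (2 powr (1/2 - r)) ^ s))"
proof -
  interpret prob_space \<mu> using \<mu> by (simp add: borel_probability_measure_def)
  have space: "space \<mu> = \<Omega>" using \<mu> by (simp add: borel_probability_measure_def)
  have "m \<ge> 1" using S(1) by (metis One_nat_def Suc_leI gr0I not_le zero_less_numeral zero_less_power)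
  define e where "e s = A * (2 ^ s) powr (- r)" for s :: nat
  define pow :: "((nat \<Rightarrow> real) \<Rightarrow> real) \<Rightarrow> (nat \<Rightarrow> real) \<Rightarrow> real" where "pow f x = \<bar>f x\<bar> powr p" for f x
  have "log 2 (real m + 1) > 0"
    using \<open>m \<ge> 1\<close> by (subst zero_less_log_cancel_iff) auto
  then have log_pos: "(log 2 (real m + 1)) powr b > 0"
    by (metis less_numeral_extra(3) powr_gt_zero)
  then have "A > 0"
    unfolding A_def using assms(1,5,6) by (intro mult_pos_pos log_pos) auto
  then have e0: "e s > 0" for s by (simp add: e_def)
  have le_M: "\<bar>f x\<bar> \<le> M" if "f \<in> W" "x \<in> \<Omega>" for f x
    using abs_le_sup_norm[OF compact, of f x] W bound that by fastforce
  have net: "\<exists>Y. finite Y \<and> card Y \<le> 2 ^ (2 ^ s) \<and> Y \<subseteq> W \<and>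
      (\<forall>f\<in>W. \<exists>g\<in>Y. \<forall>x\<in>\<Omega>. \<bar>pow f x - pow g x\<bar> \<le> e s)" if "s \<le> S" for s
  proof -
    let ?E = "B * (2 ^ s) powr (- r) * (log 2 (real m + 1)) powr b"
    have "(2::nat) ^ s \<le> 2 ^ S" using that by (intro power_increasing) auto
    then have "real (2 ^ s) \<le> real m" using S(1) by (simp only: of_nat_le_iff)
    then have "log 2 (2 ^ s + 1) \<le> log 2 (real m + 1)"
      using log_mono[of 2 "2 ^ s + 1" "real m + 1"] by (auto simp: add_pos_pos)
    moreover have "0 \<le> log 2 (2 ^ s + 1)"
      using log_mono[of 2 1 "2 ^ s + 1"] by simp
    ultimately have "(log 2 (2 ^ s + 1)) powr b \<le> (log 2 (real m + 1)) powr b"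
      using assms(4) by (intro powr_mono2)
    then have "B * (2 ^ s) powr (- r) * (log 2 (2 ^ s + 1)) powr b \<le> ?E"
      using assms(6) by (intro mult_left_mono) auto
    moreover have "entropy_number (sup_norm \<Omega>) W (2 ^ s)
        \<le> ennreal (B * (2 ^ s) powr (- r) * (log 2 (2 ^ s + 1)) powr b)"
      using entropy[rule_format, of "2 ^ s"] by simp
    ultimately have "entropy_number (sup_norm \<Omega>) W (2 ^ s) \<le> ennreal ?E"
      by (meson ennreal_leI order.trans)
    moreover have "?E > 0" using log_pos assms(6) by (intro mult_pos_pos) auto
    ultimately obtain Y where Y: "finite Y" "card Y \<le> 2 ^ (2 ^ s)" "Y \<subseteq> W"
      "\<And>f. f \<in> W \<Longrightarrow> \<exists>g\<in>Y. sup_norm \<Omega> (f - g) \<le> 2 * ?E"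
      using entropy_number_net[of "sup_norm \<Omega>" W "2 ^ s" ?E "2 * ?E"] by auto
    have "\<exists>g\<in>Y. \<forall>x\<in>\<Omega>. \<bar>pow f x - pow g x\<bar> \<le> e s" if f: "f \<in> W" for f
    proof -
      obtain g where g: "g \<in> Y" "sup_norm \<Omega> (f - g) \<le> 2 * ?E" using Y(4)[OF f] by blast
      have "\<bar>pow f x - pow g x\<bar> \<le> e s" if x: "x \<in> \<Omega>" for x
      proof -
        have "\<bar>f x - g x\<bar> \<le> 2 * ?E"
          using abs_le_sup_norm_diff[OF compact, of f g x] f g Y(3) W x by fastforce
        have "\<bar>pow f x - pow g x\<bar> \<le> p * M powr (p - 1) * \<bar>f x - g x\<bar>"
          unfolding pow_def using le_M f g(1) Y(3) x assms(1) by (intro abs_powr_lipschitz) auto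
        also have "\<dots> \<le> p * M powr (p - 1) * (2 * ?E)"
          using assms(1) \<open>\<bar>f x - g x\<bar> \<le> 2 * ?E\<close> by (intro mult_left_mono) auto
        also have "\<dots> = e s" by (simp add: e_def A_def)
        finally show ?thesis .
      qed
      then show ?thesis using g(1) by blast
    qed
    then show ?thesis using Y by blast
  qed
  then have "\<forall>s\<in>{..S}. \<exists>Y. finite Y \<and> card Y \<le> 2 ^ (2 ^ s) \<and> Y \<subseteq> W \<and>
      (\<forall>f\<in>W. \<exists>g\<in>Y. \<forall>x\<in>\<Omega>. \<bar>pow f x - pow g x\<bar> \<le> e s)"
    by simp
  from bchoice[OF this] obtain Y where "\<forall>s\<in>{..S}. finite (Y s) \<and> card (Y s) \<le> 2 ^ (2 ^ s) \<and> Y s \<subseteq> W \<and>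
      (\<forall>f\<in>W. \<exists>g\<in>Y s. \<forall>x\<in>\<Omega>. \<bar>pow f x - pow g x\<bar> \<le> e s)" ..
  then have Y: "\<And>s. s \<le> S \<Longrightarrow> finite (Y s)" "\<And>s. s \<le> S \<Longrightarrow> card (Y s) \<le> 2 ^ (2 ^ s)"
      "\<And>s. s \<le> S \<Longrightarrow> Y s \<subseteq> W"
      "\<And>s f. s \<le> S \<Longrightarrow> f \<in> W \<Longrightarrow> \<exists>g\<in>Y s. \<forall>x\<in>\<Omega>. \<bar>pow f x - pow g x\<bar> \<le> e s"
    by simp_all
  obtain \<xi> where \<xi>: "\<forall>j\<in>{1..m}. \<xi> j \<in> \<Omega>"
    and err: "\<And>h. h \<in> pow ` W \<Longrightarrow> sampling_error \<mu> m \<xi> h \<le> 2 * e S + M powr p * sqrt (8 / real m)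
           + (\<Sum>s<S. (e s + e (Suc s)) * sqrt (8 * 2 ^ Suc s / real m))"
  proof (rule chaining_sampling[of m "pow ` W" "M powr p" S "\<lambda>s. pow ` Y s" e])
    show "h \<in> borel_measurable \<mu>" if h: "h \<in> pow ` W" for h
    proof -
      obtain f where f: "f \<in> W" "h = pow f" using h by blast
      have [measurable]: "f \<in> borel_measurable \<mu>"
        using continuous_functions_measurable[OF \<mu>] f(1) W compact compactin_subset_topspace by blast
      show ?thesis unfolding f(2) pow_def by measurable
    qed
    show "\<bar>h x\<bar> \<le> M powr p" if "h \<in> pow ` W" "x \<in> space \<mu>" for h x
      using that le_M assms(1) by (auto simp: space pow_def intro!: powr_mono2)
    show "card (pow ` Y s) \<le> 2 ^ (2 ^ s)" if "s \<le> S" for s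
      using card_image_le[OF Y(1)[OF that], of pow] Y(2)[OF that] by linarith
    show "\<exists>y\<in>pow ` Y s. \<forall>x\<in>space \<mu>. \<bar>h x - y x\<bar> \<le> e s" if "s \<le> S" "h \<in> pow ` W" for s h
      using Y(4)[OF that(1)] that(2) by (auto simp: space)
    show "pow ` Y s \<subseteq> pow ` W" if "s \<le> S" for s
      using Y(3)[OF that] by (rule image_mono)
  qed (use \<open>m \<ge> 1\<close> Y(1) e0 assms(5) in \<open>auto simp: space\<close>)
  have sum: "2 * e S + M powr p * sqrt (8 / real m)
       + (\<Sum>s<S. (e s + e (Suc s)) * sqrt (8 * 2 ^ Suc s / real m))
     \<le> 4 * A * real m powr (- r) + 3 * M powr p * real m powr (-1/2)
       + 8 * A * real m powr (-1/2) * (\<Sum>s<S. (2 powr (1/2 - r)) ^ s)"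
    unfolding e_def using \<open>A > 0\<close> assms(2,3) S by (intro chaining_sum_bound) auto
  show ?thesis
    unfolding discretization_number_def
  proof (rule INF_lower2[of \<xi>])
    show "(SUP f\<in>W. ennreal \<bar>Lp_norm_pow \<mu> p f - (1 / real m) * (\<Sum>j=1..m. \<bar>f (\<xi> j)\<bar> powr p)\<bar>)
       \<le> ennreal (4 * A * real m powr (- r) + 3 * M powr p * real m powr (-1/2)
       + 8 * A * real m powr (-1/2) * (\<Sum>s<S. (2 powr (1/2 - r)) ^ s))"
    proof (intro SUP_least ennreal_leI)
      fix f assume "f \<in> W"
      then have "sampling_error \<mu> m \<xi> (pow f) \<le> 4 * A * real m powr (- r) + 3 * M powr p * real m powr (-1/2)
       + 8 * A * real m powr (-1/2) * (\<Sum>s<S. (2 powr (1/2 - r)) ^ s)"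
        using err[of "pow f"] sum by simp
      then show "\<bar>Lp_norm_pow \<mu> p f - (1 / real m) * (\<Sum>j=1..m. \<bar>f (\<xi> j)\<bar> powr p)\<bar>
        \<le> 4 * A * real m powr (- r) + 3 * M powr p * real m powr (-1/2)
       + 8 * A * real m powr (-1/2) * (\<Sum>s<S. (2 powr (1/2 - r)) ^ s)"
        by (simp add: sampling_error_def Lp_norm_pow_def pow_def)
    qed
  qed (use \<xi> in simp)
qed

theorem theorem1p2:
  fixes p r b M B :: real
  assumes "1 \<le> p" and "0 < r" and "r \<le> 1/2" and "0 \<le> b" and "0 < M" and "0 < B"
  shows "\<exists>C>0. \<forall>(d::nat) (\<Omega>::(nat \<Rightarrow> real) set) (\<mu>::(nat \<Rightarrow> real) measure)
             (W::((nat \<Rightarrow> real) \<Rightarrow> real) set).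
           d \<ge> 1 \<longrightarrow>
           compactin (Euclidean_space d) \<Omega> \<longrightarrow>
           borel_probability_measure d \<Omega> \<mu> \<longrightarrow>
           W \<subseteq> continuous_functions d \<Omega> \<longrightarrow>
           (\<forall>f\<in>W. sup_norm \<Omega> f \<le> M) \<longrightarrow>
           (\<forall>n::nat. n \<ge> 1 \<longrightarrow>
              entropy_number (sup_norm \<Omega>) W n
                \<le> ennreal (B * real n powr (- r) * (log 2 (real n + 1)) powr b)) \<longrightarrow>
           (r < 1/2 \<longrightarrow> (\<forall>m::nat. m \<ge> 1 \<longrightarrow>
              discretization_number \<Omega> \<mu> p W m
                \<le> ennreal (C * real m powr (- r) * (log 2 (real m + 1)) powr b))) \<and>
           (r = 1/2 \<longrightarrow> (\<forall>m::nat. m \<ge> 1 \<longrightarrow>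
              discretization_number \<Omega> \<mu> p W m
                \<le> ennreal (C * real m powr (- (1/2)) * (log 2 (real m + 1)) powr (b + 1))))"
proof -
  define c where "c = p * M powr (p - 1) * (2 * B)"
  define a where "a = M powr p"
  define C where "C = (if r < 1/2 then 4 * c + 3 * a + 8 * c / (2 powr (1/2 - r) - 1) else 12 * c + 3 * a)"
  have c: "c > 0" and a: "a > 0" using assms by (simp_all add: c_def a_def)
  have "8 * c / (2 powr (1/2 - r) - 1) > 0" if "r < 1/2"
    using c that by (intro divide_pos_pos) auto
  then have "C > 0" using c a by (cases "r < 1/2") (simp_all add: C_def add_pos_pos)
  show ?thesis
  proof (intro exI[of _ C] conjI[OF \<open>C > 0\<close>] allI impI, goal_cases)
    case (1 d \<Omega> \<mu> W)
    have chain: "\<exists>S. 2 ^ S \<le> m \<and> discretization_number \<Omega> \<mu> p W m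
       \<le> ennreal (4 * (c * (log 2 (real m + 1)) powr b) * real m powr (- r) + 3 * a * real m powr (-1/2)
          + 8 * (c * (log 2 (real m + 1)) powr b) * real m powr (-1/2) * (\<Sum>s<S. (2 powr (1/2 - r)) ^ s))"
      if m: "m \<ge> 1" for m :: nat
    proof -
      obtain S where S: "2 ^ S \<le> m" "m < 2 ^ Suc S"
        using ex_power_ivl1[of 2 m] m by auto
      with discretization_number_chaining[OF assms S 1(2-6)] show ?thesis
        unfolding c_def a_def by blast
    qed
    show ?case
    proof (intro conjI allI impI)
      fix m :: nat assume "r < 1/2" "m \<ge> 1"
      from chain[OF this(2)] obtain S where S: "2 ^ S \<le> m"
        and bound: "discretization_number \<Omega> \<mu> p W m
       \<le> ennreal (4 * (c * (log 2 (real m + 1)) powr b) * real m powr (- r) + 3 * a * real m powr (-1/2)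
          + 8 * (c * (log 2 (real m + 1)) powr b) * real m powr (-1/2) * (\<Sum>s<S. (2 powr (1/2 - r)) ^ s))"
        by blast
      have "C = 4 * c + 3 * a + 8 * c / (2 powr (1/2 - r) - 1)"
        using \<open>r < 1/2\<close> by (simp add: C_def)
      then show "discretization_number \<Omega> \<mu> p W m
          \<le> ennreal (C * real m powr (- r) * (log 2 (real m + 1)) powr b)"
        using chaining_rate_subcritical[OF \<open>r < 1/2\<close> assms(4) _ _ S \<open>m \<ge> 1\<close>, of c a] c a
        by (intro order.trans[OF bound] ennreal_leI) simp
    next
      fix m :: nat assume "r = 1/2" "m \<ge> 1"
      from chain[OF this(2)] obtain S where S: "2 ^ S \<le> m"
        and bound: "discretization_number \<Omega> \<mu> p W m
       \<le> ennreal (4 * (c * (log 2 (real m + 1)) powr b) * real m powr (- r) + 3 * a * real m powr (-1/2)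
          + 8 * (c * (log 2 (real m + 1)) powr b) * real m powr (-1/2) * (\<Sum>s<S. (2 powr (1/2 - r)) ^ s))"
        by blast
      have "C = 12 * c + 3 * a"
        using \<open>r = 1/2\<close> by (simp add: C_def)
      then show "discretization_number \<Omega> \<mu> p W m
          \<le> ennreal (C * real m powr (- (1/2)) * (log 2 (real m + 1)) powr (b + 1))"
        using chaining_rate_critical[OF assms(4) _ _ S \<open>m \<ge> 1\<close>, of c a] c a
        by (intro order.trans[OF bound] ennreal_leI) (simp add: \<open>r = 1/2\<close>)
    qed
  qed
qed

end
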